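(* Let $\mathbb F$ be a field of characteristic $2$ and let $(L,[\cdot,\cdot],(\cdot)^{[2]})$ be a restricted Lie algebra over $\mathbb F$. If $(m_t,\omega_t)$ and $(m'_t,\omega'_t)$ are two equivalent restricted formal deformations of $L$, then their infinitesimals $(m_1,\omega_1)$ and $(m_1',\omega_1')$ are cohomologous, i.e. $(m_1+m_1',\omega_1+\omega_1')\in B^2_{*_2}(L,L)$.
   Context: A restricted Lie algebra in characteristic $2$ is a Lie algebra $L$ with a map $(\cdot)^{[2]}:L\to L$ such that $(\lambda x)^{[2]}=\lambda^2x^{[2]}$, $[x,y^{[2]}]=[[x,y],y]$, $(x+y)^{[2]}=x^{[2]}+y^{[2]}+[x,y]$. Restricted formal deformation of $L$: maps $m_t=\sum_{i\ge0}t^im_i:L\times L\to L[[t]]$ and $\omega_t=\sum_{i\ge0}t^i\omega_i:L\to L[[t]]$ with $m_0=[\cdot,\cdot]$, $\omega_0=(\cdot)^{[2]}$, each $m_i:L\times L\to L$ bilinear antisymmetric, each $\omega_i:L\to L$ with $\omega_i(\lambda x)=\lambda^2\omega_i(x)$, such that, $m_t$ being extended to $L[[t]]$ by $m_t(\sum_it^ix_i,\sum_jt^jy_j)=\sum_{i,j}t^{i+j}m_t(x_i,y_j)$, for all $x,y,z\in L$: $m_t(x,m_t(y,z))+m_t(y,m_t(z,x))+m_t(z,m_t(x,y))=0$; $m_t(x,\omega_t(y))=m_t(m_t(x,y),y)$; $\omega_t(x+y)=\omega_t(x)+\omega_t(y)+m_t(x,y)$. The map $\omega_t$ is extended to $L[[t]]$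 by $\omega_t(\sum_it^ix_i)=\sum_it^{2i}\omega_t(x_i)+\sum_{i<j}t^{i+j}m_t(x_i,x_j)$. Equivalence: $(m_t,\omega_t)$ and $(m'_t,\omega'_t)$ are equivalent if there is $\phi_t=\sum_{i\ge0}t^i\phi_i$, with $\phi_i:L\to L$ linear, $\phi_0=\mathrm{id}$, extended to $L[[t]]$ by $\phi_t(\sum_it^ix_i)=\sum_it^i\phi_t(x_i)$, such that for all $x,y\in L$: $m'_t(\phi_t(x),\phi_t(y))=\phi_t(m_t(x,y))$ and $\phi_t(\omega_t(x))=\omega'_t(\phi_t(x))$. $B^2_{*_2}(L,L)$ is the set of pairs $(d^1_{CE}\psi,\delta^1\psi)$, $\psi:L\to L$ linear, with $d^1_{CE}\psi(x,y)=\psi([x,y])+[x,\psi(y)]+[\psi(x),y]$ and $\delta^1\psi(x)=\psi(x^{[2]})+[x,\psi(x)]$. *)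

theory Defs
  imports "HOL-Computational_Algebra.Formal_Power_Series"
begin

definition bilinear_map :: "('k::field \<Rightarrow> 'a::ab_group_add \<Rightarrow> 'a) \<Rightarrow> ('a \<Rightarrow> 'a \<Rightarrow> 'a) \<Rightarrow> bool" where
  "bilinear_map scale b \<longleftrightarrow>
     (\<forall>x. Vector_Spaces.linear scale scale (\<lambda>y. b x y)) \<and>
     (\<forall>y. Vector_Spaces.linear scale scale (\<lambda>x. b x y))"

locale lie_algebra = vector_space scale
  for scale :: "'k::field \<Rightarrow> 'a::ab_group_add \<Rightarrow> 'a" +
  fixes bracket :: "'a \<Rightarrow> 'a \<Rightarrow> 'a"
  assumes bracket_bilinear: "bilinear_map scale bracket"
    and bracket_self: "bracket x x = 0"
    and jacobi: "bracket x (bracket y z) + bracket y (bracket z x) + bracket z (bracket x y) = 0"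

text \<open>
  These are the axioms of a restricted Lie algebra in characteristic 2; the condition on the
  characteristic of the ground field is not part of the locale and has to be assumed separately.
\<close>

locale restricted_lie_algebra_char2 = lie_algebra scale bracket
  for scale :: "'k::field \<Rightarrow> 'a::ab_group_add \<Rightarrow> 'a"
    and bracket :: "'a \<Rightarrow> 'a \<Rightarrow> 'a" +
  fixes sq :: "'a \<Rightarrow> 'a"
  assumes sq_scale: "sq (scale c x) = scale (c ^ 2) (sq x)"
    and bracket_sq: "bracket x (sq y) = bracket (bracket x y) y"
    and sq_add: "sq (x + y) = sq x + sq y + bracket x y"

text \<open>
  \<open>L[[t]]\<close> is the additive group \<^typ>\<open>'a fps\<close>, with \<open>L\<close> embedded by \<^const>\<open>fps_const\<close>.
  A formal sum of maps \<open>\<Sum>i. t^i f\<^sub>i\<close> is given by its sequence of coefficients \<open>f\<^sub>i\<close>;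
  the next two functions turn such a sequence into a map from \<open>L\<close>, resp. \<open>L \<times> L\<close>, to \<open>L[[t]]\<close>.
\<close>

definition formal_map :: "(nat \<Rightarrow> 'a \<Rightarrow> 'a) \<Rightarrow> 'a \<Rightarrow> 'a::zero fps" where
  "formal_map f x = Abs_fps (\<lambda>i. f i x)"

definition formal_map2 :: "(nat \<Rightarrow> 'a \<Rightarrow> 'a \<Rightarrow> 'a) \<Rightarrow> 'a \<Rightarrow> 'a \<Rightarrow> 'a::zero fps" where
  "formal_map2 m x y = Abs_fps (\<lambda>i. m i x y)"

text \<open>
  The extensions to \<open>L[[t]]\<close>. The infinite sums are written coefficientwise: the coefficient
  of \<open>t^n\<close> in \<open>t^k u\<close> is \<^term>\<open>fps_nth u (n - k)\<close> if \<open>k \<le> n\<close>, and \<open>0\<close> otherwise, so only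
  finitely many summands contribute to each coefficient.
\<close>

definition ext_linear :: "(nat \<Rightarrow> 'a \<Rightarrow> 'a) \<Rightarrow> 'a fps \<Rightarrow> 'a::ab_group_add fps" where
  "ext_linear \<phi> X = Abs_fps (\<lambda>n. \<Sum>i | i \<le> n. fps_nth (formal_map \<phi> (fps_nth X i)) (n - i))"

definition ext_bilinear :: "(nat \<Rightarrow> 'a \<Rightarrow> 'a \<Rightarrow> 'a) \<Rightarrow> 'a fps \<Rightarrow> 'a fps \<Rightarrow> 'a::ab_group_add fps" where
  "ext_bilinear m X Y = Abs_fps (\<lambda>n. \<Sum>(i, j) | i + j \<le> n.
     fps_nth (formal_map2 m (fps_nth X i) (fps_nth Y j)) (n - (i + j)))"

definition ext_square ::
  "(nat \<Rightarrow> 'a \<Rightarrow> 'a \<Rightarrow> 'a) \<Rightarrow> (nat \<Rightarrow> 'a \<Rightarrow> 'a) \<Rightarrow> 'a fps \<Rightarrow> 'a::ab_group_add fps" where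
  "ext_square m \<omega> X = Abs_fps (\<lambda>n.
     (\<Sum>i | 2 * i \<le> n. fps_nth (formal_map \<omega> (fps_nth X i)) (n - 2 * i)) +
     (\<Sum>(i, j) | i < j \<and> i + j \<le> n.
        fps_nth (formal_map2 m (fps_nth X i) (fps_nth X j)) (n - (i + j))))"

definition restricted_formal_deformation ::
  "('k::field \<Rightarrow> 'a::ab_group_add \<Rightarrow> 'a) \<Rightarrow> ('a \<Rightarrow> 'a \<Rightarrow> 'a) \<Rightarrow> ('a \<Rightarrow> 'a) \<Rightarrow>
   (nat \<Rightarrow> 'a \<Rightarrow> 'a \<Rightarrow> 'a) \<Rightarrow> (nat \<Rightarrow> 'a \<Rightarrow> 'a) \<Rightarrow> bool" where
  "restricted_formal_deformation scale bracket sq m \<omega> \<longleftrightarrow>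
     m 0 = bracket \<and> \<omega> 0 = sq \<and>
     (\<forall>i. bilinear_map scale (m i)) \<and>
     (\<forall>i x y. m i x y = - m i y x) \<and>
     (\<forall>i c x. \<omega> i (scale c x) = scale (c ^ 2) (\<omega> i x)) \<and>
     (\<forall>x y z. ext_bilinear m (fps_const x) (formal_map2 m y z) +
              ext_bilinear m (fps_const y) (formal_map2 m z x) +
              ext_bilinear m (fps_const z) (formal_map2 m x y) = 0) \<and>
     (\<forall>x y. ext_bilinear m (fps_const x) (formal_map \<omega> y) =
            ext_bilinear m (formal_map2 m x y) (fps_const y)) \<and>
     (\<forall>x y. formal_map \<omega> (x + y) = formal_map \<omega> x + formal_map \<omega> y + formal_map2 m x y)"

definition equivalent_deformations ::
  "('k::field \<Rightarrow> 'a::ab_group_add \<Rightarrow> 'a) \<Rightarrow>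
   (nat \<Rightarrow> 'a \<Rightarrow> 'a \<Rightarrow> 'a) \<Rightarrow> (nat \<Rightarrow> 'a \<Rightarrow> 'a) \<Rightarrow>
   (nat \<Rightarrow> 'a \<Rightarrow> 'a \<Rightarrow> 'a) \<Rightarrow> (nat \<Rightarrow> 'a \<Rightarrow> 'a) \<Rightarrow> bool" where
  "equivalent_deformations scale m \<omega> m' \<omega>' \<longleftrightarrow>
     (\<exists>\<phi>. (\<forall>i. Vector_Spaces.linear scale scale (\<phi> i)) \<and> \<phi> 0 = id \<and>
        (\<forall>x y. ext_bilinear m' (formal_map \<phi> x) (formal_map \<phi> y) =
               ext_linear \<phi> (formal_map2 m x y)) \<and>
        (\<forall>x. ext_linear \<phi> (formal_map \<omega> x) = ext_square m' \<omega>' (formal_map \<phi> x)))"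

definition d1_CE :: "('a \<Rightarrow> 'a \<Rightarrow> 'a) \<Rightarrow> ('a \<Rightarrow> 'a) \<Rightarrow> 'a \<Rightarrow> 'a \<Rightarrow> 'a::ab_group_add" where
  "d1_CE bracket \<psi> x y = \<psi> (bracket x y) + bracket x (\<psi> y) + bracket (\<psi> x) y"

definition delta1 ::
  "('a \<Rightarrow> 'a \<Rightarrow> 'a) \<Rightarrow> ('a \<Rightarrow> 'a) \<Rightarrow> ('a \<Rightarrow> 'a) \<Rightarrow> 'a \<Rightarrow> 'a::ab_group_add" where
  "delta1 bracket sq \<psi> x = \<psi> (sq x) + bracket x (\<psi> x)"

definition B2 ::
  "('k::field \<Rightarrow> 'a::ab_group_add \<Rightarrow> 'a) \<Rightarrow> ('a \<Rightarrow> 'a \<Rightarrow> 'a) \<Rightarrow> ('a \<Rightarrow> 'a) \<Rightarrow>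
   (('a \<Rightarrow> 'a \<Rightarrow> 'a) \<times> ('a \<Rightarrow> 'a)) set" where
  "B2 scale bracket sq =
     {(d1_CE bracket \<psi>, delta1 bracket sq \<psi>) | \<psi>. Vector_Spaces.linear scale scale \<psi>}"

end

theory Submission
  imports Defs
begin

text \<open>
  Comparing the coefficients of \<open>t\<close> in the two equivalence conditions gives
  \<open>m'\<^sub>1(x, y) + [\<phi>\<^sub>1 x, y] + [x, \<phi>\<^sub>1 y] = \<phi>\<^sub>1 [x, y] + m\<^sub>1(x, y)\<close> and
  \<open>\<phi>\<^sub>1 (x\<^sup>[\<^sup>2\<^sup>]) + \<omega>\<^sub>1 x = \<omega>'\<^sub>1 x + [x, \<phi>\<^sub>1 x]\<close>. In characteristic \<open>2\<close> this says that the sum of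
  the infinitesimals is the coboundary of \<open>\<phi>\<^sub>1\<close>.
\<close>

text \<open>The characteristic belongs to the scalars (\<open>'a\<close> here); it reaches a vector
  by writing \<open>x + x\<close> as \<open>scale 2 x\<close>.\<close>

lemma (in vector_space) add_self_eq_0:
  fixes x :: 'b
  assumes "CHAR('a) = 2"
  shows "x + x = 0"
proof -
  have "(2 :: 'a) = 0"
    using of_nat_CHAR[where 'a = 'a] assms by simp
  moreover have "x + x = scale 2 x"
    using scale_left_distrib[of 1 1 x] by simp
  ultimately show ?thesis
    by simp
qed

lemma ext_linear_nth_1:
  "fps_nth (ext_linear \<phi> X) 1 = \<phi> 1 (fps_nth X 0) + \<phi> 0 (fps_nth X 1)"
proof -
  have "{i. i \<le> (1::nat)} = {0, 1}"
    by auto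
  then show ?thesis
    by (simp add: ext_linear_def formal_map_def)
qed

lemma ext_bilinear_nth_1:
  "fps_nth (ext_bilinear m X Y) 1 =
     m 1 (fps_nth X 0) (fps_nth Y 0) + m 0 (fps_nth X 0) (fps_nth Y 1) + m 0 (fps_nth X 1) (fps_nth Y 0)"
proof -
  have "{(i, j). i + j \<le> (1::nat)} = {(0, 0), (0, 1), (1, 0)}"
    by auto
  then show ?thesis
    by (simp add: ext_bilinear_def formal_map2_def add.assoc)
qed

text \<open>Squaring doubles exponents, so \<open>\<omega> 0 (fps_nth X 1)\<close> first appears at
  \<open>t^2\<close>; at order 1 the coefficient of \<open>X\<close> at \<open>t\<close> enters only
  through the cross term of the pair \<open>(0, 1)\<close>.\<close>

lemma ext_square_nth_1:
  "fps_nth (ext_square m \<omega> X) 1 = \<omega> 1 (fps_nth X 0) + m 0 (fps_nth X 0) (fps_nth X 1)"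
proof -
  have "{i. 2 * i \<le> (1::nat)} = {0}" "{(i, j). i < j \<and> i + j \<le> (1::nat)} = {(0, 1)}"
    by auto
  then show ?thesis
    by (simp add: ext_square_def formal_map_def formal_map2_def)
qed

theorem proposition4p16:
  fixes scale :: "'k::field \<Rightarrow> 'a::ab_group_add \<Rightarrow> 'a"
    and bracket :: "'a \<Rightarrow> 'a \<Rightarrow> 'a" and sq :: "'a \<Rightarrow> 'a"
    and m m' :: "nat \<Rightarrow> 'a \<Rightarrow> 'a \<Rightarrow> 'a" and \<omega> \<omega>' :: "nat \<Rightarrow> 'a \<Rightarrow> 'a"
  assumes "CHAR('k) = 2"
    and "restricted_lie_algebra_char2 scale bracket sq"
    and "restricted_formal_deformation scale bracket sq m \<omega>"
    and "restricted_formal_deformation scale bracket sq m' \<omega>'"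
    and "equivalent_deformations scale m \<omega> m' \<omega>'"
  shows "((\<lambda>x y. m 1 x y + m' 1 x y), (\<lambda>x. \<omega> 1 x + \<omega>' 1 x)) \<in> B2 scale bracket sq"
proof -
  interpret restricted_lie_algebra_char2 scale bracket sq
    by fact
  have zero_order: "m 0 = bracket" "\<omega> 0 = sq" "m' 0 = bracket"
    using assms(3,4) by (auto simp: restricted_formal_deformation_def)
  obtain \<phi> where linear: "Vector_Spaces.linear scale scale (\<phi> 1)" and \<phi>0: "\<phi> 0 = id"
    and bilin: "\<And>x y. ext_bilinear m' (formal_map \<phi> x) (formal_map \<phi> y) = ext_linear \<phi> (formal_map2 m x y)"
    and square: "\<And>x. ext_linear \<phi> (formal_map \<omega> x) = ext_square m' \<omega>' (formal_map \<phi> x)"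
    using assms(5) unfolding equivalent_deformations_def by blast
  \<comment> \<open>Signs disappear in characteristic 2: this turns the differences obtained below
    by solving for \<open>m' 1\<close> and \<open>\<omega>' 1\<close> into the sums that define
    \<open>d1_CE\<close> and \<open>delta1\<close>.\<close>
  have neg: "- x = x" for x :: 'a
    using add_self_eq_0[OF assms(1)] by (rule minus_unique)
  have "m 1 x y + m' 1 x y = d1_CE bracket (\<phi> 1) x y" for x y
  proof -
    have "m' 1 x y + bracket x (\<phi> 1 y) + bracket (\<phi> 1 x) y = \<phi> 1 (bracket x y) + m 1 x y"
      \<comment> \<open>Since \<open>\<phi> 0 = id\<close>, the series
        \<open>formal_map \<phi> x\<close> starts with \<open>x\<close> and then
        \<open>\<phi> 1 x\<close>.\<close>
      using arg_cong[OF bilin[of x y], of "\<lambda>X. fps_nth X 1"]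
      unfolding ext_bilinear_nth_1 ext_linear_nth_1
      by (simp add: formal_map_def formal_map2_def zero_order \<phi>0)
    then have "m' 1 x y = \<phi> 1 (bracket x y) + m 1 x y - bracket x (\<phi> 1 y) - bracket (\<phi> 1 x) y"
      by (simp add: algebra_simps)
    then have "m 1 x y + m' 1 x y = (m 1 x y + m 1 x y) + d1_CE bracket (\<phi> 1) x y"
      unfolding diff_conv_add_uminus neg by (simp add: d1_CE_def algebra_simps)
    then show ?thesis
      using add_self_eq_0[OF assms(1)] by simp
  qed
  moreover have "\<omega> 1 x + \<omega>' 1 x = delta1 bracket sq (\<phi> 1) x" for x
  proof -
    have "\<phi> 1 (sq x) + \<omega> 1 x = \<omega>' 1 x + bracket x (\<phi> 1 x)"
      using arg_cong[OF square[of x], of "\<lambda>X. fps_nth X 1"]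
      unfolding ext_square_nth_1 ext_linear_nth_1
      by (simp add: formal_map_def zero_order \<phi>0)
    then have "\<omega>' 1 x = \<phi> 1 (sq x) + \<omega> 1 x - bracket x (\<phi> 1 x)"
      by (simp add: algebra_simps)
    \<comment> \<open>Adding \<open>\<omega> 1 x\<close> to both sides doubles it on the right,
      where it vanishes.\<close>
    then have "\<omega> 1 x + \<omega>' 1 x = (\<omega> 1 x + \<omega> 1 x) + delta1 bracket sq (\<phi> 1) x"
      unfolding diff_conv_add_uminus neg by (simp add: delta1_def algebra_simps)
    then show ?thesis
      using add_self_eq_0[OF assms(1)] by simp
  qed
  ultimately show ?thesis
    using linear unfolding B2_def by auto
qed

end
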